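(* Let $n \ge 4$ and let the hiding devil play Gauss's circle strategy on the $n$-dimensional infinite grid against the drunk angel of power $c$. Then for a given $c \in \mathbb{N}$ and a real number $\epsilon>0$, $P[A^{n}_{k,c}] \to 0$ as $k \to \infty$.
   Context: The $n$-dimensional infinite grid has vertex set $\mathbb{Z}^n$. For $x=(x_1,\dots,x_n)$ let $\|x\| = \max_i |x_i|$ and $d(x,y)=\|x-y\|$. The lattice sphere of radius $r$ is $L^n_r = \{x \in \mathbb{Z}^n : \|x\| \le r\}$, and the hollow lattice sphere of inner radius $k$ and thickness $c$ is $H^n_{k,c} = L^n_{k+c} \setminus L^n_{k-1}$. The drunk angel of power $c$ starts at the origin and in each turn moves from her current vertex $x$ to each vertex $y$ with $d(x,y)\le c$ with probability $\frac{1}{(2c+1)^n}$, independently of previous turns. Gauss's circle strategy: the hiding devil secretly destroys one vertex per turn for $N = |H^n_{k,c}|$ turns, building $H^n_{k,c}$; destroyed vertices do not affect the angel's moves. After the angel's $N$-th move the devil reveals $H^n_{k,c}$, and $A^n_{k,c}$ is the event that the angel's position then lies in the inner part of $H^n_{k,c}$ (the region it encloses, i.e. points at distance less than $k$ from the origin). *)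

theory Defs
  imports "HOL-Probability.Probability"
begin

text \<open>The grid \<open>\<int>\<^sup>n\<close> is the type \<^typ>\<open>int ^ 'n\<close>, with \<open>n = CARD('n)\<close>.\<close>

definition grid_norm :: "int ^ 'n \<Rightarrow> int" where
  "grid_norm x = Max (range (\<lambda>i. \<bar>x $ i\<bar>))"

definition grid_dist :: "int ^ 'n \<Rightarrow> int ^ 'n \<Rightarrow> int" where
  "grid_dist x y = grid_norm (x - y)"

text \<open>Radii are integers, so that the sphere of radius \<open>k - 1\<close> is empty for \<open>k = 0\<close>.\<close>

definition lattice_sphere :: "int \<Rightarrow> (int ^ 'n) set" where
  "lattice_sphere r = {x. grid_norm x \<le> r}"

definition hollow_sphere :: "nat \<Rightarrow> nat \<Rightarrow> (int ^ 'n) set" where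
  "hollow_sphere k c = lattice_sphere (int k + int c) - lattice_sphere (int k - 1)"

definition inner_part :: "nat \<Rightarrow> (int ^ 'n) set" where
  "inner_part k = {x. grid_dist x 0 < int k}"

definition angel_step :: "nat \<Rightarrow> int ^ 'n \<Rightarrow> (int ^ 'n) pmf" where
  "angel_step c x = pmf_of_set {y. grid_dist x y \<le> int c}"

text \<open>Distribution of the angel's position after a given number of moves. Each move is drawn
  afresh given the current vertex, and the destroyed vertices play no role.\<close>

primrec angel_position :: "nat \<Rightarrow> nat \<Rightarrow> (int ^ 'n) pmf" where
  "angel_position c 0 = return_pmf 0"
| "angel_position c (Suc t) = angel_position c t \<bind> angel_step c"

text \<open>The probability of the event \<open>A\<^sup>n\<^sub>k\<^sub>,\<^sub>c\<close>. The devil destroys one vertex of the hollow sphere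
  per turn, so it is complete after as many turns as it has vertices; the order in which they are
  destroyed is immaterial. The type argument carries the dimension.\<close>

definition prob_caught :: "'n::finite itself \<Rightarrow> nat \<Rightarrow> nat \<Rightarrow> real" where
  "prob_caught _ k c =
     measure_pmf.prob (angel_position c (card (hollow_sphere k c :: (int ^ 'n) set)))
       (inner_part k :: (int ^ 'n) set)"

text \<open>\<^const>\<open>pmf_of_set\<close> and \<^const>\<open>card\<close> are only meaningful here because the sets involved
  are finite and non-empty.\<close>

lemma grid_norm_le_iff: "grid_norm x \<le> r \<longleftrightarrow> (\<forall>i. \<bar>x $ i\<bar> \<le> r)"
  unfolding grid_norm_def by (subst Max_le_iff) auto

lemma grid_ball_eq:
  "{y. grid_dist x y \<le> r} = vec_lambda ` (PiE UNIV (\<lambda>i. {x $ i - r..x $ i + r}))"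
proof (intro set_eqI iffI)
  fix y assume "y \<in> {y. grid_dist x y \<le> r}"
  then have "vec_nth y \<in> PiE UNIV (\<lambda>i. {x $ i - r..x $ i + r})"
    by (auto simp: grid_dist_def grid_norm_le_iff abs_le_iff PiE_def Pi_def algebra_simps)
  then show "y \<in> vec_lambda ` (PiE UNIV (\<lambda>i. {x $ i - r..x $ i + r}))"
    by (metis imageI vec_nth_inverse)
next
  fix y assume "y \<in> vec_lambda ` (PiE UNIV (\<lambda>i. {x $ i - r..x $ i + r}))"
  then obtain f where f: "y = vec_lambda f" "\<And>i. f i \<in> {x $ i - r..x $ i + r}"
    by (metis (no_types, lifting) PiE_mem UNIV_I imageE)
  have "\<bar>x $ i - f i\<bar> \<le> r" for i
    using f(2)[of i] by auto
  then show "y \<in> {y. grid_dist x y \<le> r}"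
    by (simp add: grid_dist_def grid_norm_le_iff f(1))
qed

lemma finite_grid_ball: "finite {y. grid_dist x y \<le> r}"
  unfolding grid_ball_eq by (intro finite_imageI finite_PiE) auto

lemma card_grid_ball:
  fixes x :: "int ^ 'n"
  shows "card {y. grid_dist x y \<le> int c} = (2 * c + 1) ^ CARD('n)"
proof -
  have "inj_on vec_lambda (PiE UNIV (\<lambda>i. {x $ i - int c..x $ i + int c}))"
    by (metis inj_onI UNIV_I vec_lambda_inject)
  then show ?thesis
    unfolding grid_ball_eq by (simp add: card_image card_PiE nat_add_distrib nat_mult_distrib)
qed

lemma finite_hollow_sphere: "finite (hollow_sphere k c :: (int ^ 'n) set)"
proof -
  have "lattice_sphere r = {y :: int ^ 'n. grid_dist 0 y \<le> r}" for r
    by (auto simp: lattice_sphere_def grid_dist_def grid_norm_le_iff)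
  then show ?thesis
    by (simp add: hollow_sphere_def finite_grid_ball)
qed

lemma pmf_angel_step:
  fixes x :: "int ^ 'n"
  shows "pmf (angel_step c x) y = (if grid_dist x y \<le> int c then 1 / (2 * real c + 1) ^ CARD('n) else 0)"
proof -
  have "card {y. grid_dist x y \<le> int c} \<noteq> 0"
    by (simp add: card_grid_ball)
  then have "{y. grid_dist x y \<le> int c} \<noteq> {}"
    by (metis card.empty)
  then show ?thesis
    unfolding angel_step_def
    by (subst pmf_of_set) (auto simp: finite_grid_ball card_grid_ball indicator_def add.commute)
qed

end

theory Submission imports Defs "HOL-Real_Asymp.Real_Asymp"
begin

text \<open>
  Follow a single coordinate \<open>S\<close> of the angel. By independence and symmetry,
  \<open>E cos (t S) = \<phi>(t)\<^sup>N\<close> after \<open>N\<close> moves, with \<open>|\<phi>(t)| \<le> 1 - \<delta> (1 - cos t)\<close> for some \<open>\<delta> > 0\<close>. Test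
  the walk against the Fejer-type kernel \<open>F(s) = |\<Sum>j<M. e\<^bsup>i j \<theta> s\<^esup>|\<^sup>2\<close> with \<open>\<theta> = 1 / (M k)\<close>: it is
  nonnegative and at least \<open>M\<^sup>2 / 4\<close> when \<open>|s| \<le> k\<close>, while \<open>E F(S)\<close> is \<open>M\<close> from the diagonal
  plus at most \<open>M\<^sup>2\<close> terms of size \<open>exp (- \<delta> N / (4 M\<^sup>2 k\<^sup>2))\<close>. Since \<open>N \<ge> k\<^sup>3\<close> for \<open>n \<ge> 4\<close>, the
  probability of being caught is at most \<open>4 / M + o(1)\<close> for every fixed \<open>M\<close>.
\<close>

section \<open>Quadratic estimates for the cosine near zero\<close>

lemma cos_ge_half:
  fixes t :: real
  assumes "\<bar>t\<bar> \<le> 1"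
  shows "1 / 2 \<le> cos t"
proof -
  have "cos (pi / 3) \<le> cos \<bar>t\<bar>"
    using assms pi_gt3 by (intro cos_monotone_0_pi_le) auto
  then show ?thesis
    by (simp add: cos_60)
qed

text \<open>Second-order Taylor expansion: the remainder contains
  \<open>cos (s + pi) = - cos s\<close>, and \<open>cos s\<close> is at least 1/2 because
  \<bar>s\<bar> \<le> \<bar>t\<bar> \<le> 1.\<close>

lemma one_minus_cos_lower:
  fixes t :: real
  assumes "\<bar>t\<bar> \<le> 1"
  shows "t\<^sup>2 / 4 \<le> 1 - cos t"
proof -
  obtain s where s: "\<bar>s\<bar> \<le> \<bar>t\<bar>"
    "cos t = (\<Sum>m<2. cos_coeff m * t ^ m) + cos (s + 1 / 2 * real 2 * pi) / fact 2 * t ^ 2"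
    using Maclaurin_cos_expansion[of t 2] by blast
  have "1 / 2 * t\<^sup>2 \<le> cos s * t\<^sup>2"
    using s(1) assms by (intro mult_right_mono cos_ge_half) auto
  moreover have "1 - cos t = cos s * t\<^sup>2 / 2"
    using s(2) by (simp add: numeral_2_eq_2 cos_coeff_def)
  ultimately show ?thesis
    by simp
qed

section \<open>Expectations of bounded functions\<close>

lemma expectation_bind_pmf_bounded:
  fixes f :: "'a \<Rightarrow> real"
  assumes "\<And>x. \<bar>f x\<bar> \<le> B"
  shows "measure_pmf.expectation (p \<bind> q) f
       = measure_pmf.expectation p (\<lambda>x. measure_pmf.expectation (q x) f)"
  unfolding measure_pmf_bind
  using assms
  by (intro integral_bind[where K = "count_space UNIV" and B' = 1 and B = B])
    (auto simp: measure_pmf.emeasure_space_1 space_subprob_algebra subprob_space_measure_pmf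
      intro: measure_pmf.finite_measure_axioms)

lemma integrable_measure_pmf_bounded:
  fixes f :: "'a \<Rightarrow> real"
  assumes "\<And>x. \<bar>f x\<bar> \<le> B"
  shows "integrable (measure_pmf p) f"
  using assms by (intro measure_pmf.integrable_const_bound[where B = B]) auto

text \<open>A nonnegative function dominates its restriction to the single atom \<open>x\<close>.
  This lets one well-chosen move bound the characteristic function of a step.\<close>

lemma pmf_mult_le_expectation:
  fixes f :: "'a \<Rightarrow> real"
  assumes "integrable (measure_pmf p) f" "\<And>y. 0 \<le> f y"
  shows "pmf p x * f x \<le> measure_pmf.expectation p f"
proof -
  have "pmf p x * f x = measure_pmf.expectation p (\<lambda>y. f x * indicator {x} y)"
    by (simp add: measure_pmf_single)
  also have "\<dots> \<le> measure_pmf.expectation p f"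
  proof (rule integral_mono)
    show "integrable (measure_pmf p) (\<lambda>y. f x * indicator {x} y)"
      by (rule integrable_measure_pmf_bounded[where B = "\<bar>f x\<bar>"]) (simp add: indicator_def)
  qed (use assms in \<open>auto simp: indicator_def\<close>)
  finally show ?thesis .
qed

section \<open>Characteristic function of a coordinate of the walk\<close>

lemma grid_ball_nonempty: "{y. grid_dist x y \<le> int c} \<noteq> {}"
proof -
  have "x \<in> {y. grid_dist x y \<le> int c}"
    by (simp add: grid_dist_def grid_norm_le_iff)
  then show ?thesis
    by blast
qed

lemma angel_step_translate: "angel_step c x = map_pmf ((+) x) (angel_step c 0)"
proof -
  have "(+) x ` {y. grid_dist 0 y \<le> int c} = {y. grid_dist x y \<le> int c}"
  proof (intro set_eqI iffI)
    fix y assume "y \<in> {y. grid_dist x y \<le> int c}"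
    then show "y \<in> (+) x ` {y. grid_dist 0 y \<le> int c}"
      by (intro image_eqI[of _ _ "y - x"]) (auto simp: grid_dist_def)
  qed (auto simp: grid_dist_def)
  moreover have "map_pmf ((+) x) (pmf_of_set {y. grid_dist 0 y \<le> int c})
      = pmf_of_set ((+) x ` {y. grid_dist 0 y \<le> int c})"
    by (rule map_pmf_of_set_inj[OF _ grid_ball_nonempty finite_grid_ball]) (rule inj_onI, simp)
  ultimately show ?thesis
    unfolding angel_step_def by (simp only:)
qed

lemma angel_step_uminus: "map_pmf uminus (angel_step c 0) = angel_step c 0"
proof -
  let ?B = "{y :: int ^ 'a. grid_dist 0 y \<le> int c}"
  have uminus_B: "- y \<in> ?B" if "y \<in> ?B" for y
    using that by (simp add: grid_dist_def grid_norm_le_iff)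
  have "uminus ` ?B = ?B"
  proof (intro equalityI subsetI)
    fix y assume "y \<in> ?B"
    then show "y \<in> uminus ` ?B"
      by (intro image_eqI[of _ _ "- y"] uminus_B) (simp only: minus_minus)
  qed (use uminus_B in blast)
  moreover have "map_pmf uminus (pmf_of_set ?B) = pmf_of_set (uminus ` ?B)"
    by (rule map_pmf_of_set_inj[OF _ grid_ball_nonempty finite_grid_ball]) (rule inj_onI, simp)
  ultimately show ?thesis
    unfolding angel_step_def by (simp only:)
qed

text \<open>The characteristic function of coordinate \<open>i\<close> of one move; a move is
  symmetric under negation, so the imaginary part vanishes and the cosine suffices.\<close>

definition step_char :: "nat \<Rightarrow> 'n::finite \<Rightarrow> real \<Rightarrow> real" where
  "step_char c i t = measure_pmf.expectation (angel_step c 0) (\<lambda>y. cos (t * real_of_int (y $ i)))"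

lemma expectation_sin_angel_step:
  "measure_pmf.expectation (angel_step c 0) (\<lambda>y. sin (t * real_of_int (y $ i))) = 0"
proof -
  have "measure_pmf.expectation (angel_step c 0) (\<lambda>y. sin (t * real_of_int (y $ i)))
      = measure_pmf.expectation (map_pmf uminus (angel_step c 0)) (\<lambda>y. sin (t * real_of_int (y $ i)))"
    by (simp only: angel_step_uminus)
  also have "\<dots> = - measure_pmf.expectation (angel_step c 0) (\<lambda>y. sin (t * real_of_int (y $ i)))"
    by simp
  finally show ?thesis
    by simp
qed

text \<open>After translation to the origin, the addition formula leaves only the cosine term. Thus
  the cosine is an eigenfunction of the transition operator, with eigenvalue
  \<open>step_char c i t\<close>.\<close>

lemma expectation_cos_angel_step:
  "measure_pmf.expectation (angel_step c x) (\<lambda>y. cos (t * real_of_int (y $ i)))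
     = step_char c i t * cos (t * real_of_int (x $ i))"
proof -
  have "measure_pmf.expectation (angel_step c x) (\<lambda>y. cos (t * real_of_int (y $ i)))
      = measure_pmf.expectation (angel_step c 0)
          (\<lambda>y. cos (t * real_of_int (x $ i)) * cos (t * real_of_int (y $ i))
             - sin (t * real_of_int (x $ i)) * sin (t * real_of_int (y $ i)))"
    by (subst angel_step_translate) (simp add: distrib_left cos_add)
  also have "\<dots> = cos (t * real_of_int (x $ i)) * step_char c i t"
    by (subst Bochner_Integration.integral_diff)
      (auto simp: expectation_sin_angel_step step_char_def
        intro!: integrable_mult_right integrable_measure_pmf_bounded[where B = 1])
  finally show ?thesis
    by simp
qed

lemma expectation_cos_angel_position:
  "measure_pmf.expectation (angel_position c N) (\<lambda>y. cos (t * real_of_int (y $ i)))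
     = step_char c i t ^ N"
proof (induction N)
  case (Suc N)
  have "measure_pmf.expectation (angel_position c (Suc N)) (\<lambda>y. cos (t * real_of_int (y $ i)))
      = measure_pmf.expectation (angel_position c N)
          (\<lambda>x. measure_pmf.expectation (angel_step c x) (\<lambda>y. cos (t * real_of_int (y $ i))))"
    by (simp, subst expectation_bind_pmf_bounded[where B = 1]) auto
  also have "\<dots> = step_char c i t ^ Suc N"
    by (simp add: expectation_cos_angel_step Suc)
  finally show ?case .
qed simp

lemma abs_step_char_le:
  fixes i :: "'n::finite"
  assumes "c \<ge> 1"
  shows "\<bar>step_char c i t\<bar> \<le> 1 - (1 - cos t) / (2 * real c + 1) ^ CARD('n)"
proof -
  let ?p = "angel_step c (0 :: int ^ 'n)"
  let ?q = "1 / (2 * real c + 1) ^ CARD('n)"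
  let ?f = "\<lambda>y :: int ^ 'n. cos (t * real_of_int (y $ i))"
  have int: "integrable (measure_pmf ?p) ?f"
    by (rule integrable_measure_pmf_bounded[where B = 1]) simp
  \<comment> \<open>The unit move along coordinate \<open>i\<close> is allowed since c \<ge> 1; its
    mass \<open>?q\<close> alone keeps the characteristic function below 1.\<close>
  have "grid_dist 0 (axis i 1) \<le> int c"
    using assms by (auto simp: grid_dist_def grid_norm_le_iff axis_def)
  then have "?q * (1 - cos t) \<le> measure_pmf.expectation ?p (\<lambda>y. 1 - ?f y)"
    using pmf_mult_le_expectation[of ?p "\<lambda>y. 1 - ?f y" "axis i 1"] int
    by (simp add: pmf_angel_step)
  then have upper: "?q * (1 - cos t) \<le> 1 - step_char c i t"
    using int by (simp add: step_char_def)
  have nonneg: "0 \<le> 1 + ?f y" for y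
    using cos_ge_minus_one[of "t * real_of_int (y $ i)"] by linarith
  \<comment> \<open>Standing still also has mass \<open>?q\<close>, which rules out values near
    -1.\<close>
  have "grid_dist 0 (0 :: int ^ 'n) \<le> int c"
    by (auto simp: grid_dist_def grid_norm_le_iff)
  then have "?q * 2 \<le> measure_pmf.expectation ?p (\<lambda>y. 1 + ?f y)"
    using pmf_mult_le_expectation[of ?p "\<lambda>y. 1 + ?f y" 0] int nonneg
    by (simp add: pmf_angel_step)
  then have lower: "?q * 2 \<le> 1 + step_char c i t"
    using int by (simp add: step_char_def)
  have "?q * (1 - cos t) \<le> ?q * 2"
    using cos_ge_minus_one[of t] by (intro mult_left_mono) (linarith, simp)
  with upper lower show ?thesis
    by (auto simp: abs_le_iff)
qed

section \<open>Fejer kernel and concentration bound\<close>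

lemma fejer_square:
  fixes u :: real
  shows "(\<Sum>j<M. \<Sum>l<M. cos ((real j - real l) * u))
       = (\<Sum>j<M. cos (real j * u))\<^sup>2 + (\<Sum>j<M. sin (real j * u))\<^sup>2"
  by (simp add: power2_eq_square sum_product left_diff_distrib cos_diff sum.distrib)

lemma angel_position_concentration:
  assumes "c \<ge> 1" "M \<ge> 1" "k \<ge> 1"
  shows "measure_pmf.prob (angel_position c N) (inner_part k :: (int ^ 'n::finite) set)
    \<le> 4 / real M + 4 * exp (- (real N / (4 * (real M * real k)\<^sup>2 * (2 * real c + 1) ^ CARD('n))))"
proof -
  \<comment> \<open>Any coordinate will do: the inner part confines each of them to [-k, k].\<close>
  fix i :: 'n
  let ?p = "angel_position c N :: (int ^ 'n) pmf"
  \<comment> \<open>The scale is chosen so that all angles \<open>real j * th * s\<close> with j < M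
    and \<bar>s\<bar> \<le> k stay in [-1, 1].\<close>
  define th where "th = 1 / (real M * real k)"
  define D where "D = (2 * real c + 1) ^ CARD('n)"
  define E where "E = exp (- (real N / (4 * (real M * real k)\<^sup>2 * D)))"
  \<comment> \<open>The double sum can be averaged term by term, while \<open>fejer_square\<close>
    rewrites it as a sum of squares for the pointwise bounds.\<close>
  define F where "F = (\<lambda>x :: int ^ 'n. \<Sum>j<M.
     \<Sum>l<M. cos ((real j - real l) * (th * real_of_int (x $ i))))"
  have "D \<ge> 1" unfolding D_def by simp
  have th: "th > 0" using assms by (simp add: th_def)
  have cos_int: "integrable (measure_pmf ?p) (\<lambda>x. cos (f x))" for f :: "int ^ 'n \<Rightarrow> real"
    by (rule integrable_measure_pmf_bounded[where B = 1]) simp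
  have F_int: "integrable (measure_pmf ?p) F"
    unfolding F_def by (intro Bochner_Integration.integrable_sum cos_int)
  have F_nonneg: "0 \<le> F x" for x
    unfolding F_def fejer_square by simp
  have F_ge: "(real M)\<^sup>2 / 4 \<le> F x" if "x \<in> inner_part k" for x
  proof -
    let ?u = "th * real_of_int (x $ i)"
    have "grid_norm x \<le> int k"
      using that by (simp add: inner_part_def grid_dist_def)
    then have "\<bar>x $ i\<bar> \<le> int k"
      by (simp add: grid_norm_le_iff)
    then have xi: "\<bar>real_of_int (x $ i)\<bar> \<le> real k"
      by linarith
    have "1 / 2 \<le> cos (real j * ?u)" if "j < M" for j
    proof (rule cos_ge_half)
      have "\<bar>real j * ?u\<bar> = real j * th * \<bar>real_of_int (x $ i)\<bar>"
        using th by (simp add: abs_mult)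
      also have "\<dots> \<le> real M * th * real k"
        using that th xi by (intro mult_mono) auto
      also have "\<dots> = 1"
        using assms by (simp add: th_def)
      finally show "\<bar>real j * ?u\<bar> \<le> 1" .
    qed
    then have "(\<Sum>j<M. 1 / 2) \<le> (\<Sum>j<M. cos (real j * ?u))"
      by (intro sum_mono) auto
    then have "(real M / 2)\<^sup>2 \<le> (\<Sum>j<M. cos (real j * ?u))\<^sup>2"
      by (intro power_mono) auto
    also have "\<dots> \<le> F x"
      unfolding F_def fejer_square by simp
    finally show ?thesis
      by (simp add: power_divide)
  qed
  \<comment> \<open>Allowing \<open>E\<close> on the diagonal too makes the final sum uniform:
    \<open>real M\<close> plus \<open>(real M)\<^sup>2 * E\<close>.\<close>
  have coeff: "step_char c i ((real j - real l) * th) ^ N \<le> (if j = l then 1 else 0) + E"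
    if "j < M" "l < M" for j l
  proof (cases "j = l")
    case True
    then show ?thesis
      by (simp add: step_char_def E_def)
  next
    case False
    let ?t = "(real j - real l) * th"
    have "1 \<le> \<bar>real j - real l\<bar>"
      using False by linarith
    then have "th \<le> \<bar>?t\<bar>"
      using th by (simp add: abs_mult)
    then have "th\<^sup>2 \<le> ?t\<^sup>2"
      using th by (metis abs_le_square_iff abs_of_pos)
    have "\<bar>?t\<bar> \<le> real M * th"
      using th that by (auto simp: abs_mult)
    also have "\<dots> \<le> 1"
      using assms by (simp add: th_def)
    finally have "?t\<^sup>2 / 4 \<le> 1 - cos ?t"
      by (rule one_minus_cos_lower)
    with \<open>th\<^sup>2 \<le> ?t\<^sup>2\<close> have "th\<^sup>2 / 4 / D \<le> (1 - cos ?t) / D"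
      using \<open>D \<ge> 1\<close> by (intro divide_right_mono) auto
    then have "\<bar>step_char c i ?t\<bar> \<le> 1 - th\<^sup>2 / 4 / D"
      using abs_step_char_le[OF assms(1), of i ?t] by (simp add: D_def)
    also have "\<dots> \<le> exp (- (th\<^sup>2 / 4 / D))"
      using exp_ge_add_one_self[of "- (th\<^sup>2 / 4 / D)"] by simp
    finally have "\<bar>step_char c i ?t\<bar> ^ N \<le> exp (- (th\<^sup>2 / 4 / D)) ^ N"
      by (intro power_mono) auto
    also have "\<dots> = E"
      by (simp add: E_def th_def power_divide flip: exp_of_nat_mult)
    finally show ?thesis
      using False abs_ge_self[of "step_char c i ?t ^ N"] by (simp add: power_abs)
  qed
  have "(real M)\<^sup>2 / 4 * measure_pmf.prob ?p (inner_part k)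
      = measure_pmf.expectation ?p (\<lambda>x. (real M)\<^sup>2 / 4 * indicator (inner_part k) x)"
    by simp
  also have "\<dots> \<le> measure_pmf.expectation ?p F"
  proof (rule integral_mono)
    show "integrable (measure_pmf ?p) (\<lambda>x. (real M)\<^sup>2 / 4 * indicator (inner_part k) x)"
      by (rule integrable_measure_pmf_bounded[where B = "(real M)\<^sup>2 / 4"])
        (simp add: indicator_def)
  qed (use F_int F_ge F_nonneg in \<open>auto simp: indicator_def\<close>)
  also have "\<dots> = (\<Sum>j<M. \<Sum>l<M. step_char c i ((real j - real l) * th) ^ N)"
    by (simp add: F_def cos_int Bochner_Integration.integral_sum
        flip: mult.assoc expectation_cos_angel_position)
  also have "\<dots> \<le> (\<Sum>j<M. \<Sum>l<M. (if j = l then 1 else 0) + E)"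
    using coeff by (intro sum_mono) auto
  also have "\<dots> = real M + (real M)\<^sup>2 * E"
    by (simp add: sum.distrib power2_eq_square algebra_simps)
  finally have "measure_pmf.prob ?p (inner_part k) \<le> (real M + (real M)\<^sup>2 * E) / ((real M)\<^sup>2 / 4)"
    using assms by (subst pos_le_divide_eq) (auto simp: mult.commute)
  also have "\<dots> = 4 / real M + 4 * E"
    using assms by (simp add: field_simps power2_eq_square)
  finally show ?thesis
    unfolding E_def D_def .
qed

section \<open>Size of the hollow sphere\<close>

lemma card_hollow_sphere_ge:
  assumes "k \<ge> 1" "CARD('n::finite) \<ge> 4"
  shows "k ^ 3 \<le> card (hollow_sphere k c :: (int ^ 'n) set)"
proof -
  let ?S = "\<lambda>r. {y :: int ^ 'n. grid_dist 0 y \<le> int r}"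
  let ?n = "CARD('n)"
  let ?b = "2 * (k - 1) + 1"
  have S: "lattice_sphere r = {y :: int ^ 'n. grid_dist 0 y \<le> r}" for r
    by (auto simp: lattice_sphere_def grid_dist_def grid_norm_le_iff)
  \<comment> \<open>k \<ge> 1 makes the natural subtraction agree with the integer radius.\<close>
  have "hollow_sphere k c = ?S (k + c) - ?S (k - 1)"
    using assms(1) by (simp only: hollow_sphere_def of_nat_diff of_nat_add of_nat_1 S)
  moreover have "?S (k - 1) \<subseteq> ?S (k + c)"
    by auto
  ultimately have card: "card (hollow_sphere k c :: (int ^ 'n) set)
      = (2 * (k + c) + 1) ^ ?n - ?b ^ ?n"
    by (simp only: card_Diff_subset finite_grid_ball card_grid_ball)
  \<comment> \<open>The outer cube has side at least \<open>?b + 1\<close>, so splitting off one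
    factor leaves a surplus of \<open>?b ^ m\<close>; the exponent 3 comes from the dimension being
    at least 4.\<close>
  obtain m where m: "?n = Suc m" "m \<ge> 3"
    using assms(2) by (cases ?n) auto
  have "k ^ 3 \<le> ?b ^ 3"
    by (intro power_mono) auto
  also have "\<dots> \<le> ?b ^ m"
    using m by (intro power_increasing) auto
  finally have "k ^ 3 + ?b ^ ?n \<le> ?b ^ m + ?b * ?b ^ m"
    using m by simp
  also have "\<dots> = (?b + 1) * ?b ^ m"
    by simp
  also have "\<dots> \<le> (2 * (k + c) + 1) * (2 * (k + c) + 1) ^ m"
    using assms(1) by (intro mult_mono power_mono) auto
  also have "\<dots> = (2 * (k + c) + 1) ^ ?n"
    by (simp add: m)
  finally show ?thesis
    unfolding card by simp
qed

section \<open>Passage to the limit\<close>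

theorem theorem4:
  fixes c :: nat and \<epsilon> :: real
  assumes "CARD('n::finite) \<ge> 4"
    and "c \<ge> 1"
    and "\<epsilon> > 0"
  shows "(\<lambda>k. prob_caught TYPE('n) k c) \<longlonglongrightarrow> 0"
proof (rule LIMSEQ_I)
  fix e :: real assume "e > 0"
  define D where "D = (2 * real c + 1) ^ CARD('n)"
  have "D > 0" by (simp add: D_def)
  \<comment> \<open>\<open>M\<close> is fixed before k grows, so that the diagonal contribution
    \<open>4 / real M\<close> is below \<open>e / 2\<close>.\<close>
  obtain M :: nat where M: "8 / e < real M"
    using reals_Archimedean2 by blast
  then have "M \<ge> 1"
    using \<open>e > 0\<close> by (cases M) (auto simp: field_simps)
  have "4 / real M < e / 2"
    using M \<open>e > 0\<close> \<open>M \<ge> 1\<close> by (simp add: field_simps)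
  \<comment> \<open>Cubic time against the quadratic scale \<open>(real M * real k)\<^sup>2\<close>
    leaves a decay exponent linear in k, with this rate.\<close>
  define a where "a = 1 / (4 * (real M)\<^sup>2 * D)"
  have "a > 0"
    using \<open>D > 0\<close> \<open>M \<ge> 1\<close> by (simp add: a_def)
  have bound: "prob_caught TYPE('n) k c \<le> 4 / real M + 4 * exp (- (a * real k))" if "k \<ge> 1" for k
  proof -
    let ?N = "card (hollow_sphere k c :: (int ^ 'n) set)"
    have "a * real k = real (k ^ 3) / (4 * (real M * real k)\<^sup>2 * D)"
      using that \<open>D > 0\<close> \<open>M \<ge> 1\<close> by (simp add: a_def field_simps power2_eq_square power3_eq_cube)
    also have "\<dots> \<le> real ?N / (4 * (real M * real k)\<^sup>2 * D)"
      using card_hollow_sphere_ge[OF that assms(1)] \<open>D > 0\<close>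
      by (intro divide_right_mono) (simp_all only: of_nat_le_iff, simp)
    finally show ?thesis
      using angel_position_concentration[OF assms(2) \<open>M \<ge> 1\<close> that, of ?N, where 'n = 'n]
      unfolding prob_caught_def D_def by (smt (verit) exp_le_cancel_iff)
  qed
  have "(\<lambda>k. 4 * exp (- (a * real k))) \<longlonglongrightarrow> 0"
    using \<open>a > 0\<close> by real_asymp
  then have "\<forall>\<^sub>F k in sequentially. 4 * exp (- (a * real k)) < e / 2"
    by (rule order_tendstoD(2)) (simp add: \<open>e > 0\<close>)
  then obtain K where K: "\<And>k. k \<ge> K \<Longrightarrow> 4 * exp (- (a * real k)) < e / 2"
    by (auto simp: eventually_sequentially)
  have "norm (prob_caught TYPE('n) k c - 0) < e" if "k \<ge> max 1 K" for k
    using bound[of k] K[of k] that \<open>4 / real M < e / 2\<close> by (simp add: prob_caught_def)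
  then show "\<exists>K. \<forall>k\<ge>K. norm (prob_caught TYPE('n) k c - 0) < e"
    by blast
qed

end
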